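(* (i) For every integer $n\ge 2$ and every real $D>0$ there exist $C^\infty$ regular simple closed curves $\Gamma$ in the Euclidean plane that are not circles and that have property $C_n(D)$. (ii) For every real $D>0$, the circle of radius $D/2$ is the only $C^2$ regular simple closed curve in the Euclidean plane which satisfies both $C_4\!\left(\frac{D}{\sqrt 2}\right)$ and $C(D)$ (uniqueness is as a subset of the plane up to the position of its center).
   Context: $\Gamma$ denotes a simple closed curve in the Euclidean plane $\mathbb{R}^2$, and $\|\cdot\|$ is the Euclidean norm. A curve is regular if it is $C^1$ with non-vanishing derivative; a $C^k$ regular simple closed curve is one admitting a closed (periodic) parametrization that is $C^k$ with nowhere vanishing derivative and injective on a period. A polygon $S$ is inscribed in $\Gamma$ at $x$ if all the vertices of $S$ lie on $\Gamma$ and one of them is $x$. Regular $n$-gons are the usual convex ones for $n\ge 3$; a line segment is considered as a (regular) $2$-gon, with edge length equal to its length. Property $C_n(D)$ (for an integer $n\ge 2$ and $D>0$): for every $x\in\Gamma$ there is a unique regular $n$-gon with edges of length $D$ inscribed in $\Gamma$ at $x$. Property $C(D)$ (for $D>0$): for every $x\in\Gamma$ there is a unique $y(x)\in\Gamma$ with $\|x-y(x)\|=D$, and $\|x-z\|<D$ for every $z\in\Gamma$ with $z\ne y(x)$. (For simple closed curves $C(D)$ is equivalent to $C_2(D)$.) *)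

theory Defs
  imports "HOL-Analysis.Analysis"
begin

text \<open>The Euclidean plane is the type \<^typ>\<open>complex\<close>, whose norm and distance are the
  Euclidean ones.\<close>

definition iter_vector_derivative :: "nat \<Rightarrow> (real \<Rightarrow> 'a::real_normed_vector) \<Rightarrow> real \<Rightarrow> 'a" where
  "iter_vector_derivative j \<gamma> = ((\<lambda>g t. vector_derivative g (at t)) ^^ j) \<gamma>"

text \<open>The order \<open>k\<close> may be \<open>\<infinity>\<close>. Since \<^const>\<open>vector_derivative\<close> is total, differentiability is
  required explicitly at every stage at which a derivative is taken.\<close>

definition C_differentiable :: "enat \<Rightarrow> (real \<Rightarrow> 'a::real_normed_vector) \<Rightarrow> bool" where
  "C_differentiable k \<gamma> \<longleftrightarrow>
     (\<forall>j. enat j < k \<longrightarrow> (\<forall>t. iter_vector_derivative j \<gamma> differentiable (at t))) \<and>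
     (\<forall>j. enat j \<le> k \<longrightarrow> continuous_on UNIV (iter_vector_derivative j \<gamma>))"

text \<open>Meaningful for \<open>k \<ge> 1\<close> only.\<close>

definition regular_simple_closed_curve :: "enat \<Rightarrow> complex set \<Rightarrow> bool" where
  "regular_simple_closed_curve k \<Gamma> \<longleftrightarrow>
     (\<exists>\<gamma> T. T > 0 \<and> (\<forall>t. \<gamma> (t + T) = \<gamma> t) \<and> inj_on \<gamma> {0..<T} \<and>
        C_differentiable k \<gamma> \<and> (\<forall>t. vector_derivative \<gamma> (at t) \<noteq> 0) \<and>
        \<Gamma> = range \<gamma>)"

definition ngon_vertex :: "nat \<Rightarrow> complex \<Rightarrow> real \<Rightarrow> real \<Rightarrow> nat \<Rightarrow> complex" where
  "ngon_vertex n c r \<theta> i = c + of_real r * cis (\<theta> + 2 * pi * real i / real n)"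

text \<open>A convex polygon, or a segment if \<open>n = 2\<close>, is represented by its set \<open>V\<close> of vertices, which
  determines it. The parameters \<open>c\<close>, \<open>r\<close> and \<open>\<theta>\<close> are the centre, the circumradius and the
  direction of one vertex.\<close>

definition regular_ngon :: "nat \<Rightarrow> real \<Rightarrow> complex set \<Rightarrow> bool" where
  "regular_ngon n D V \<longleftrightarrow>
     (\<exists>c r \<theta>. r > 0 \<and> V = ngon_vertex n c r \<theta> ` {..<n} \<and>
        (\<forall>i<n. dist (ngon_vertex n c r \<theta> i) (ngon_vertex n c r \<theta> (Suc i)) = D))"

definition inscribed_at :: "complex set \<Rightarrow> complex set \<Rightarrow> complex \<Rightarrow> bool" where
  "inscribed_at V \<Gamma> x \<longleftrightarrow> V \<subseteq> \<Gamma> \<and> x \<in> V"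

definition property_Cn :: "nat \<Rightarrow> real \<Rightarrow> complex set \<Rightarrow> bool" where
  "property_Cn n D \<Gamma> \<longleftrightarrow> (\<forall>x\<in>\<Gamma>. \<exists>!V. regular_ngon n D V \<and> inscribed_at V \<Gamma> x)"

definition property_C :: "real \<Rightarrow> complex set \<Rightarrow> bool" where
  "property_C D \<Gamma> \<longleftrightarrow>
     (\<forall>x\<in>\<Gamma>. \<exists>y\<in>\<Gamma>. norm (x - y) = D \<and> (\<forall>y'\<in>\<Gamma>. norm (x - y') = D \<longrightarrow> y' = y) \<and>
        (\<forall>z\<in>\<Gamma>. z \<noteq> y \<longrightarrow> norm (x - z) < D))"

end

theory Submission
  imports Defs
begin

text \<open>
  For the existence part, a regular \<open>n\<close>-gon of edge length \<open>D\<close> rotates at unit speed while its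
  centre moves along a small closed curve \<open>m\<close> of period \<open>2 * pi / n\<close>. All its vertices then
  trace the same curve \<open>m t + r * cis t\<close>, at each point of which an \<open>n\<close>-gon is inscribed. Uniqueness
  (\<open>property_Cn_perturbed_circle\<close>) amounts to the fact that the only points of the curve at distance
  \<open>D\<close> from a given one are the two neighbouring vertices. For \<open>n \<ge> 3\<close> the centre moves on a small
  circle, \<open>m t = e * cis (n * t)\<close>; the points in question are transversal intersections with a
  circle of radius \<open>D\<close> and persist under small perturbations, which is made explicit by the
  inequality \<open>abs_sin_n_le_product\<close>. For \<open>n = 2\<close> the two neighbours coincide and the intersection
  is a tangency. The centre moves on a deltoid instead, with velocity orthogonal to the rotating
  diameter, which gives a curve of constant width (\<open>property_C2_rounded_deltoid\<close>). The curves have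
  rotational symmetries but no constant distance from the centre of symmetry, so they are not
  circles.

  For the characterization of the circle, the property \<open>C(D)\<close> implies that each point of \<open>\<Gamma>\<close>
  lies on a diameter of length \<open>D\<close> that is normal to \<open>\<Gamma>\<close>
  (\<open>antipode_along_fixed_normal\<close>), so the midpoint of the diameter can only move orthogonally to
  it. The inscribed square at a point has the diameter there as one diagonal, and its other diagonal
  is a diameter with the same midpoint in the orthogonal direction. So the midpoint does not move at
  all, \<open>\<Gamma>\<close> lies on a circle about it (\<open>sphere_if_property_C4_and_C\<close>), and a connected subset of a
  circle that contains with each point its antipode is the whole circle
  (\<open>eq_sphere_if_antipodal\<close>).
\<close>

section \<open>Chords and periodic functions\<close>

text \<open>The angles \<open>(s - t) / 2\<close> and \<open>(s + t) / 2\<close> separate in a chord of a trigonometric curve: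
  the former governs its length, and all the distance estimates below start from this
  factorization.\<close>

lemma cis_diff: "cis a - cis b = 2 * \<i> * of_real (sin ((a - b) / 2)) * cis ((a + b) / 2)"
proof -
  have "cos a - cos b = - (2 * sin ((a - b) / 2) * sin ((a + b) / 2))"
    using cos_diff_cos[of a b] sin_minus[of "(a - b) / 2"]
    by (simp add: minus_divide_left mult_ac)
  then show ?thesis
    using sin_diff_sin[of a b] by (simp add: complex_eq_iff)
qed

lemma abs_sin_of_nat_mult_le: "\<bar>sin (real n * x)\<bar> \<le> real n * \<bar>sin x\<bar>"
proof (induction n)
  case (Suc n)
  have "\<bar>sin (real (Suc n) * x)\<bar> = \<bar>sin (real n * x) * cos x + cos (real n * x) * sin x\<bar>"
    unfolding sin_add[symmetric] by (simp add: algebra_simps)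
  also have "\<dots> \<le> \<bar>sin (real n * x)\<bar> * \<bar>cos x\<bar> + \<bar>cos (real n * x)\<bar> * \<bar>sin x\<bar>"
    by (metis abs_mult abs_triangle_ineq)
  also have "\<dots> \<le> \<bar>sin (real n * x)\<bar> * 1 + 1 * \<bar>sin x\<bar>"
    by (intro add_mono mult_mono) auto
  also have "\<dots> \<le> real (Suc n) * \<bar>sin x\<bar>"
    using Suc by (simp add: algebra_simps)
  finally show ?case .
qed simp

lemma periodic_int_shift:
  fixes f :: "real \<Rightarrow> 'a"
  assumes per: "\<And>t. f (t + T) = f t"
  shows "f (t + of_int k * T) = f t"
proof -
  have nat: "f (t + real n * T) = f t" for n t
  proof (induction n)
    case (Suc n)
    have "f (t + real (Suc n) * T) = f ((t + real n * T) + T)"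
      by (simp add: algebra_simps)
    with Suc per show ?case by simp
  qed simp
  show ?thesis
  proof (cases "k \<ge> 0")
    case True
    then show ?thesis using nat[of t "nat k"] by simp
  next
    case False
    then show ?thesis using nat[of "t + of_int k * T" "nat (- k)"] by simp
  qed
qed

lemma cis_add_int_2pi: "cis (t + of_int k * (2 * pi)) = cis t"
  by (rule periodic_int_shift) (simp add: cis_mult[symmetric])

lemma periodic_eq_if_sin_eq_0:
  fixes f :: "real \<Rightarrow> 'a"
  assumes "\<And>t. f (t + 2 * pi) = f t" "sin ((s - t) / 2) = 0"
  shows "f s = f t"
proof -
  obtain k :: int where "(s - t) / 2 = of_int k * pi"
    using assms(2) by (auto simp: sin_zero_iff_int2)
  then have "s = t + of_int k * (2 * pi)" by simp
  then show ?thesis using periodic_int_shift[of f "2 * pi" t k] assms(1) by simp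
qed

section \<open>Regular polygons\<close>

text \<open>Indexing the vertices by all integers makes the choice of a first vertex immaterial.\<close>

lemma ngon_vertices_eq_range:
  assumes "n > 0"
  shows "ngon_vertex n c r \<theta> ` {..<n} =
         range (\<lambda>k::int. c + of_real r * cis (\<theta> + 2 * pi * of_int k / real n))" (is "?L = range ?f")
proof
  show "?L \<subseteq> range ?f"
  proof (rule image_subsetI)
    fix i
    have "ngon_vertex n c r \<theta> i = ?f (int i)" by (simp add: ngon_vertex_def)
    then show "ngon_vertex n c r \<theta> i \<in> range ?f" by blast
  qed
  show "range ?f \<subseteq> ?L"
  proof (rule image_subsetI)
    fix k :: int
    define i where "i = nat (k mod int n)"
    have i: "int i = k mod int n" "i < n"
      using assms by (auto simp: i_def nat_less_iff)
    have "k = int i + int n * (k div int n)" by (simp add: i)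
    then have "real_of_int k = real i + real n * of_int (k div int n)"
      by (metis of_int_add of_int_mult of_int_of_nat_eq)
    then have "\<theta> + 2 * pi * of_int k / real n
        = (\<theta> + 2 * pi * real i / real n) + of_int (k div int n) * (2 * pi)"
      using assms by (simp add: field_simps)
    moreover have "cis ((\<theta> + 2 * pi * real i / real n) + of_int (k div int n) * (2 * pi))
        = cis (\<theta> + 2 * pi * real i / real n)"
      by (rule cis_add_int_2pi)
    ultimately have "?f k = ngon_vertex n c r \<theta> i"
      by (simp only: ngon_vertex_def)
    then show "?f k \<in> ?L" using i by blast
  qed
qed

lemma dist_ngon_vertices:
  assumes "n > 0" "r > 0"
  shows "dist (ngon_vertex n c r \<theta> i) (ngon_vertex n c r \<theta> (Suc i)) = 2 * r * sin (pi / real n)"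
proof -
  have half: "((\<theta> + 2 * pi * real i / real n) - (\<theta> + 2 * pi * real (Suc i) / real n)) / 2
      = - (pi / real n)"
    using assms by (simp add: field_simps)
  have "sin (pi / real n) \<ge> 0"
    using assms by (intro sin_ge_zero) (auto simp: field_simps)
  moreover have "ngon_vertex n c r \<theta> i - ngon_vertex n c r \<theta> (Suc i)
      = of_real r * (cis (\<theta> + 2 * pi * real i / real n) - cis (\<theta> + 2 * pi * real (Suc i) / real n))"
    by (simp add: ngon_vertex_def algebra_simps)
  ultimately show ?thesis
    using assms unfolding dist_norm cis_diff half by (simp add: norm_mult)
qed

text \<open>A regular \<open>n\<close>-gon of given edge length is determined by one vertex \<open>x\<close> and the direction
  from its centre to \<open>x\<close>, because the edge length fixes the circumradius.\<close>

lemma regular_ngon_at: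
  assumes n: "n \<ge> 2" and r: "r > 0" and V: "regular_ngon n (2 * r * sin (pi / real n)) V"
    and x: "x \<in> V"
  obtains \<theta> where "V = range (\<lambda>k::int. x - of_real r * cis \<theta>
      + of_real r * cis (\<theta> + 2 * pi * of_int k / real n))"
proof -
  have n0: "n > 0" using n by simp
  obtain c R \<theta> where R: "R > 0" and Veq: "V = ngon_vertex n c R \<theta> ` {..<n}"
    and D: "\<forall>i<n. dist (ngon_vertex n c R \<theta> i) (ngon_vertex n c R \<theta> (Suc i))
        = 2 * r * sin (pi / real n)"
    using V unfolding regular_ngon_def by blast
  have "sin (pi / real n) > 0"
    using n by (intro sin_gt_zero) (auto simp: field_simps)
  then have "R = r"
    using D n0 dist_ngon_vertices[OF n0 R, of c \<theta> 0] by auto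
  with Veq have Vr: "V = range (\<lambda>k::int. c + of_real r * cis (\<theta> + 2 * pi * of_int k / real n))"
    using ngon_vertices_eq_range[OF n0] by simp
  then obtain j :: int where j: "x = c + of_real r * cis (\<theta> + 2 * pi * of_int j / real n)"
    using x by blast
  define \<phi> where "\<phi> = \<theta> + 2 * pi * of_int j / real n"
  have shift: "\<phi> + 2 * pi * of_int k / real n = \<theta> + 2 * pi * of_int (j + k) / real n" for k :: int
    using n0 by (simp add: \<phi>_def field_simps)
  have "range (\<lambda>k::int. c + of_real r * cis (\<theta> + 2 * pi * of_int k / real n))
      = range ((\<lambda>k::int. c + of_real r * cis (\<theta> + 2 * pi * of_int k / real n)) \<circ> (\<lambda>k. j + k))"
    unfolding image_comp[symmetric] by simp
  also have "\<dots> = range (\<lambda>k::int. x - of_real r * cis \<phi>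
      + of_real r * cis (\<phi> + 2 * pi * of_int k / real n))"
    unfolding shift by (simp add: j \<phi>_def o_def)
  finally show thesis using Vr that by blast
qed

text \<open>Let the centre of a regular \<open>n\<close>-gon of circumradius \<open>r\<close> move along \<open>m\<close> while the polygon
  rotates at unit speed. If \<open>m\<close> has period \<open>2 * pi / n\<close>, then after the angle \<open>2 * pi / n\<close> the
  polygon has returned to its position with each vertex moved to the next one, so that all vertices
  trace the same closed curve, and an \<open>n\<close>-gon is inscribed at each point. It is the only one as
  soon as no points of the curve other than the two neighbouring vertices lie at the distance of the
  edge length: the sum of the two neighbours of \<open>x\<close> in an \<open>n\<close>-gon determines its centre.\<close>

lemma property_Cn_perturbed_circle:
  fixes m :: "real \<Rightarrow> complex"
  assumes n: "n \<ge> 2" and r: "r > 0"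
    and per: "\<And>t. m (t + 2 * pi / real n) = m t"
    and \<gamma>: "\<And>t. \<gamma> t = m t + of_real r * cis t"
    and dist: "\<And>s t. dist (\<gamma> s) (\<gamma> t) = 2 * r * sin (pi / real n) \<Longrightarrow>
        sin ((s - t) / 2 - pi / real n) = 0 \<or> sin ((s - t) / 2 + pi / real n) = 0"
  shows "property_Cn n (2 * r * sin (pi / real n)) (range \<gamma>)"
  unfolding property_Cn_def
proof
  define D where "D = 2 * r * sin (pi / real n)"
  have n0: "n > 0" using n by simp
  have mshift: "m (t + 2 * pi * of_int k / real n) = m t" for t and k :: int
    using periodic_int_shift[of m "2 * pi / real n" t k] per by (simp add: mult_ac)
  have \<gamma>per: "\<gamma> (t + 2 * pi) = \<gamma> t" for t
    using mshift[of t "int n"] n0 by (simp add: \<gamma> cis_mult[symmetric])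
  fix x assume "x \<in> range \<gamma>"
  then obtain t where t: "x = \<gamma> t" by blast
  define V where "V = ngon_vertex n (m t) r t ` {..<n}"
  have V: "V = range (\<lambda>k::int. \<gamma> (t + 2 * pi * of_int k / real n))"
    unfolding V_def ngon_vertices_eq_range[OF n0] by (simp add: \<gamma> mshift)
  have "regular_ngon n D V"
    unfolding regular_ngon_def V_def D_def using r dist_ngon_vertices[OF n0 r] by blast
  moreover have "x \<in> V"
    unfolding V t by (rule range_eqI[of _ _ 0]) simp
  moreover have "V \<subseteq> range \<gamma>" unfolding V by blast
  moreover have "W = V" if W: "regular_ngon n D W" and sub: "W \<subseteq> range \<gamma>" and xW: "x \<in> W" for W
  proof -
    define p where "p = 2 * pi / real n"
    obtain \<theta> where \<theta>: "W = range (\<lambda>k::int. x - of_real r * cis \<theta>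
        + of_real r * cis (\<theta> + 2 * pi * of_int k / real n))"
      using regular_ngon_at[OF n r W[unfolded D_def] xW] .
    define a where "a = x - of_real r * cis \<theta> + of_real r * cis (\<theta> + p)"
    define b where "b = x - of_real r * cis \<theta> + of_real r * cis (\<theta> - p)"
    have aW: "a \<in> W" unfolding \<theta> a_def p_def by (rule range_eqI[of _ _ 1]) simp
    have bW: "b \<in> W" unfolding \<theta> b_def p_def by (rule range_eqI[of _ _ "- 1"]) simp
    have s0: "sin (p / 2) > 0"
      using n unfolding p_def by (intro sin_gt_zero) (auto simp: field_simps)
    have da: "dist a x = D" "dist b x = D"
    proof -
      have "a - x = of_real r * (cis (\<theta> + p) - cis \<theta>)"
        by (simp add: a_def algebra_simps)
      then show "dist a x = D"
        unfolding dist_norm cis_diff using s0 r by (simp add: norm_mult D_def p_def)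
      have "b - x = of_real r * (cis (\<theta> - p) - cis \<theta>)"
        by (simp add: b_def algebra_simps)
      then show "dist b x = D"
        unfolding dist_norm cis_diff using s0 r by (simp add: norm_mult D_def p_def)
    qed
    have nbr: "y = \<gamma> (t + p) \<or> y = \<gamma> (t - p)" if y: "y \<in> range \<gamma>" and d: "dist y x = D" for y
    proof -
      obtain s where s: "y = \<gamma> s" using y by blast
      have "sin ((s - t) / 2 - pi / real n) = 0 \<or> sin ((s - t) / 2 + pi / real n) = 0"
        using d dist[of s t] unfolding s t D_def by blast
      moreover have "(s - t) / 2 - pi / real n = (s - (t + p)) / 2"
        "(s - t) / 2 + pi / real n = (s - (t - p)) / 2"
        by (auto simp: p_def field_simps)
      ultimately show ?thesis
        unfolding s using periodic_eq_if_sin_eq_0[of \<gamma>, OF \<gamma>per] by metis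
    qed
    \<comment> \<open>The two neighbours of \<open>x\<close> in \<open>W\<close> may correspond to \<open>t + p\<close> and \<open>t - p\<close> in either order;
      only their sum is used, which also covers the coincidence of both for \<open>n = 2\<close>.\<close>
    have ab: "a = \<gamma> (t + p) \<or> a = \<gamma> (t - p)" "b = \<gamma> (t + p) \<or> b = \<gamma> (t - p)"
      using nbr aW bW da sub by blast+
    have sum: "a + b = \<gamma> (t + p) + \<gamma> (t - p)"
    proof (cases "n = 2")
      case True
      have "sin (((t + p) - (t - p)) / 2) = 0" using True by (simp add: p_def)
      then have "\<gamma> (t + p) = \<gamma> (t - p)"
        by (rule periodic_eq_if_sin_eq_0[of \<gamma>, OF \<gamma>per])
      with ab show ?thesis by auto
    next
      case False
      with n have n3: "real n \<ge> 3" by simp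
      have "sin p > 0"
        unfolding p_def
      proof (intro sin_gt_zero)
        show "2 * pi / real n < pi" using n3 pi_gt_zero by (simp add: field_simps)
      qed (use n3 in auto)
      moreover have "a - b = of_real r * (cis (\<theta> + p) - cis (\<theta> - p))"
        by (simp add: a_def b_def algebra_simps)
      ultimately have "a \<noteq> b"
        using r unfolding cis_diff by (auto simp: cis_neq_zero)
      with ab show ?thesis by auto
    qed
    have cissum: "cis (\<phi> + p) + cis (\<phi> - p) - 2 * cis \<phi> = of_real (2 * (cos p - 1)) * cis \<phi>" for \<phi>
      by (simp add: complex_eq_iff cos_add cos_diff sin_add sin_diff algebra_simps)
    have m: "m (t + p) = m t" "m (t - p) = m t"
      using mshift[of t 1] mshift[of t "- 1"] by (simp_all add: p_def)
    have "of_real r * (of_real (2 * (cos p - 1)) * cis \<theta>) = a + b - 2 * x"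
      unfolding cissum[symmetric] a_def b_def by (simp add: algebra_simps)
    also have "\<dots> = of_real r * (of_real (2 * (cos p - 1)) * cis t)"
      unfolding cissum[symmetric] sum t \<gamma> m by (simp add: algebra_simps)
    finally have "of_real r * (of_real (2 * (cos p - 1)) * cis \<theta>)
        = of_real r * (of_real (2 * (cos p - 1)) * cis t)" .
    moreover have "cos p \<noteq> 1"
      using s0 cos_double_sin[of "p / 2"] by auto
    ultimately have c: "cis \<theta> = cis t" using r
      by (simp del: of_real_mult of_real_diff)
    show ?thesis
      unfolding \<theta> V cis_mult[symmetric] c by (simp add: t \<gamma> mshift cis_mult)
  qed
  ultimately show "\<exists>!V. regular_ngon n (2 * r * sin (pi / real n)) V \<and> inscribed_at V (range \<gamma>) x"
    unfolding inscribed_at_def D_def by blast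
qed

section \<open>Smooth perturbations of a circle\<close>

text \<open>The iterated derivatives are given explicitly, so that sums of exponentials are smooth by
  inspection and their velocity can be read off.\<close>

definition derivative_tower :: "(real \<Rightarrow> 'a::real_normed_vector) \<Rightarrow> (nat \<Rightarrow> real \<Rightarrow> 'a) \<Rightarrow> bool" where
  "derivative_tower f g \<longleftrightarrow> g 0 = f \<and> (\<forall>j t. (g j has_vector_derivative g (Suc j) t) (at t))"

lemma derivative_tower_add:
  "derivative_tower f g \<Longrightarrow> derivative_tower f' g' \<Longrightarrow>
    derivative_tower (\<lambda>t. f t + f' t) (\<lambda>j t. g j t + g' j t)"
  by (auto simp: derivative_tower_def intro!: has_vector_derivative_add)

lemma has_vector_derivative_cis_mult:
  "((\<lambda>t. cis (k * t)) has_vector_derivative \<i> * of_real k * cis (k * t)) (at t)"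
  unfolding has_vector_derivative_complex_iff
  by (auto intro!: derivative_eq_intros)

lemma derivative_tower_cis:
  "derivative_tower (\<lambda>t. a * cis (k * t)) (\<lambda>j t. a * (\<i> * of_real k) ^ j * cis (k * t))"
  unfolding derivative_tower_def
proof (intro conjI allI)
  fix j t
  show "((\<lambda>t. a * (\<i> * of_real k) ^ j * cis (k * t)) has_vector_derivative
      a * (\<i> * of_real k) ^ Suc j * cis (k * t)) (at t)"
    using has_vector_derivative_mult_right[OF has_vector_derivative_cis_mult,
        of "a * (\<i> * of_real k) ^ j" k t]
    by (simp add: mult_ac)
qed simp

lemma C_differentiable_if_derivative_tower:
  assumes "derivative_tower f g"
  shows "C_differentiable k f"
proof -
  have g0: "g 0 = f" and gs: "(g j has_vector_derivative g (Suc j) t) (at t)" for j t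
    using assms by (auto simp: derivative_tower_def)
  have it: "iter_vector_derivative j f = g j" for j
  proof (induction j)
    case 0
    then show ?case by (simp add: iter_vector_derivative_def g0)
  next
    case (Suc j)
    then show ?case
      using vector_derivative_at[OF gs] by (simp add: iter_vector_derivative_def)
  qed
  have "g j differentiable (at t)" for j t
    using gs by (rule differentiableI_vector)
  moreover have "continuous_on UNIV (g j)" for j
    using has_vector_derivative_continuous[OF gs] by (simp add: continuous_at_imp_continuous_on)
  ultimately show ?thesis by (simp add: C_differentiable_def it)
qed

text \<open>Two points of the circle have the distance \<open>2 * r * \<bar>sin ((s - t) / 2)\<bar>\<close>. A displacement \<open>m\<close>
  whose variation is smaller than this by a constant factor cannot bring them together, and one with
  velocity below \<open>r\<close> cannot stop the motion.\<close>

lemma regular_simple_closed_perturbed_circle: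
  fixes m :: "real \<Rightarrow> complex"
  assumes per: "\<And>t. m (t + 2 * pi) = m t"
    and g: "derivative_tower m g" and g1: "\<And>t. norm (g 1 t) < r"
    and lip: "\<And>s t. norm (m s - m t) \<le> 2 * K * \<bar>sin ((s - t) / 2)\<bar>" and K: "K < r"
  shows "regular_simple_closed_curve k (range (\<lambda>t. m t + of_real r * cis t))"
proof -
  define \<gamma> where "\<gamma> = (\<lambda>t. m t + of_real r * cis t)"
  have r: "r > 0" using g1[of 0] norm_ge_zero[of "g 1 0"] by linarith
  have tower: "derivative_tower \<gamma> (\<lambda>j t. g j t + of_real r * (\<i> * of_real 1) ^ j * cis (1 * t))"
    using derivative_tower_add[OF g derivative_tower_cis[of "of_real r" 1]] by (simp add: \<gamma>_def)
  have vd: "vector_derivative \<gamma> (at t) = g 1 t + of_real r * \<i> * cis t" for t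
    using tower unfolding derivative_tower_def
    by (auto intro!: vector_derivative_at elim: allE[of _ 0])
  have nz: "vector_derivative \<gamma> (at t) \<noteq> 0" for t
  proof
    assume "vector_derivative \<gamma> (at t) = 0"
    then have "g 1 t = - (of_real r * \<i> * cis t)"
      by (simp add: vd eq_neg_iff_add_eq_0)
    then have "norm (g 1 t) = r" using r by (simp add: norm_mult)
    with g1[of t] show False by simp
  qed
  have inj: "inj_on \<gamma> {0..<2 * pi}"
  proof (rule inj_onI)
    fix s t assume st: "s \<in> {0..<2 * pi}" "t \<in> {0..<2 * pi}" and eq: "\<gamma> s = \<gamma> t"
    have "m s - m t = - (of_real r * (cis s - cis t))"
      using eq by (simp add: \<gamma>_def algebra_simps)
    then have "norm (m s - m t) = 2 * r * \<bar>sin ((s - t) / 2)\<bar>"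
      using r unfolding cis_diff by (simp add: norm_mult)
    with lip[of s t] have "(r - K) * \<bar>sin ((s - t) / 2)\<bar> \<le> 0"
      by (simp add: algebra_simps)
    with K have "sin ((s - t) / 2) = 0"
      by (simp add: mult_le_0_iff)
    then obtain i :: int where i: "(s - t) / 2 = of_int i * pi"
      by (auto simp: sin_zero_iff_int2)
    then have "s - t = 2 * pi * of_int i" by simp
    moreover have "\<bar>s - t\<bar> < 2 * pi" using st by auto
    ultimately have "\<bar>real_of_int i\<bar> < 1"
      by (simp add: abs_mult)
    then have "i = 0" by linarith
    with i show "s = t" by simp
  qed
  show ?thesis
    unfolding regular_simple_closed_curve_def \<gamma>_def[symmetric]
    using inj nz C_differentiable_if_derivative_tower[OF tower]
    by (intro exI[of _ \<gamma>] exI[of _ "2 * pi"]) (auto simp: \<gamma>_def per cis_mult[symmetric])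
qed

text \<open>A circle that is invariant under a nontrivial rotation about \<open>0\<close> is centred at \<open>0\<close>.\<close>

lemma not_sphere_if_rotation_invariant:
  fixes \<Gamma> :: "complex set"
  assumes \<omega>: "norm \<omega> = 1" "\<omega> \<noteq> 1" and inv: "\<And>p. p \<in> \<Gamma> \<Longrightarrow> \<omega> * p \<in> \<Gamma>"
    and pq: "p \<in> \<Gamma>" "q \<in> \<Gamma>" "norm p \<noteq> norm q" and R: "R > 0"
  shows "\<Gamma> \<noteq> sphere c R"
proof
  assume sph: "\<Gamma> = sphere c R"
  define d where "d = c - \<omega> * c"
  have "c = 0"
  proof (rule ccontr)
    assume "c \<noteq> 0"
    then have d0: "d \<noteq> 0" using \<omega> by (auto simp: d_def algebra_simps)
    have \<omega>0: "\<omega> \<noteq> 0" using \<omega> by auto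
    \<comment> \<open>The point of the circle which the rotation carries farthest away from \<open>c\<close>.\<close>
    define a where "a = c - of_real R * sgn d / \<omega>"
    have "norm (c - a) = R"
      using R d0 \<omega> by (simp add: a_def norm_mult norm_divide norm_sgn)
    then have "a \<in> \<Gamma>" by (simp add: sph dist_norm)
    from inv[OF this] have "norm (c - \<omega> * a) = R" by (simp add: sph dist_norm)
    also have "c - \<omega> * a = d + of_real R * sgn d"
      using \<omega>0 by (simp add: a_def d_def algebra_simps)
    also have "\<dots> = of_real (norm d + R) * sgn d"
      using d0 by (simp add: sgn_eq algebra_simps)
    also have "norm \<dots> = norm d + R"
      using R d0 by (simp add: norm_mult norm_sgn del: of_real_add)
    finally show False using d0 by simp
  qed
  then show False using pq by (simp add: sph)
qed

section \<open>Epitrochoids carry inscribed polygons with at least three vertices\<close>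

lemma sin_sq_diff: "sin v ^ 2 - sin a ^ 2 = sin (v - a) * sin (v + a)" for a v :: real
  using sin_cos_squared_add[of v] sin_cos_squared_add[of a]
  unfolding sin_diff sin_add by algebra

text \<open>Both \<open>v = pi / n\<close> and \<open>v = - pi / n\<close> are zeros of \<open>sin (n * v)\<close>, so each factor on the right
  bounds \<open>\<bar>sin (n * v)\<bar>\<close> up to the constant \<open>n\<close>. The two factors are not small at the same time,
  by the addition theorem for \<open>sin (2 * (pi / n))\<close>, so the product is a bound as well. For
  \<open>n = 2\<close> this constant vanishes, which is why segments require a different curve.\<close>

lemma abs_sin_n_le_product:
  assumes n: "n \<ge> 3"
  shows "sin (2 * (pi / real n)) * \<bar>sin (real n * v)\<bar>
    \<le> 2 * real n * \<bar>sin (v - pi / real n) * sin (v + pi / real n)\<bar>"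
proof -
  define a where "a = pi / real n"
  have na: "real n * a = pi" using n by (simp add: a_def)
  have s: "\<bar>sin (real n * v)\<bar> \<le> real n * \<bar>sin (v - a)\<bar>" "\<bar>sin (real n * v)\<bar> \<le> real n * \<bar>sin (v + a)\<bar>"
    using abs_sin_of_nat_mult_le[of n "v - a"] abs_sin_of_nat_mult_le[of n "v + a"]
    by (simp_all add: right_diff_distrib distrib_left na)
  have "sin (2 * a) = sin ((v + a) - (v - a))" by simp
  also have "\<dots> = sin (v + a) * cos (v - a) - cos (v + a) * sin (v - a)" by (rule sin_diff)
  also have "\<dots> \<le> \<bar>sin (v + a)\<bar> * \<bar>cos (v - a)\<bar> + \<bar>cos (v + a)\<bar> * \<bar>sin (v - a)\<bar>"
    unfolding abs_mult[symmetric] by linarith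
  also have "\<dots> \<le> \<bar>sin (v + a)\<bar> * 1 + 1 * \<bar>sin (v - a)\<bar>"
    by (intro add_mono mult_mono) auto
  finally have "sin (2 * a) * \<bar>sin (real n * v)\<bar>
      \<le> \<bar>sin (v + a)\<bar> * \<bar>sin (real n * v)\<bar> + \<bar>sin (v - a)\<bar> * \<bar>sin (real n * v)\<bar>"
    unfolding distrib_right[symmetric] by (intro mult_right_mono) auto
  also have "\<dots> \<le> \<bar>sin (v + a)\<bar> * (real n * \<bar>sin (v - a)\<bar>) + \<bar>sin (v - a)\<bar> * (real n * \<bar>sin (v + a)\<bar>)"
    using s by (intro add_mono mult_left_mono) auto
  also have "\<dots> = 2 * real n * \<bar>sin (v - a) * sin (v + a)\<bar>" by (simp add: abs_mult)
  finally show ?thesis by (simp add: a_def)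
qed

text \<open>With \<open>v = (s - t) / 2\<close> and \<open>a = pi / n\<close>, the square of half a chord exceeds that of half the
  prescribed edge by \<open>r\<^sup>2 * sin (v - a) * sin (v + a)\<close>, up to an error of the size
  \<open>e * sin (n * v)\<close>. The error vanishes to the same order as the main term, so for small \<open>e\<close> the
  perturbation creates no new points at the distance of the edge length. The case \<open>e = 0\<close> is the
  circle.\<close>

lemma property_Cn_epitrochoid:
  assumes n: "n \<ge> 3" and r: "r > 0" and e: "e \<ge> 0"
    and small: "2 * real n * (e * (2 * r + real n * e)) < sin (2 * (pi / real n)) * r ^ 2"
  shows "property_Cn n (2 * r * sin (pi / real n))
    (range (\<lambda>t. (c + of_real e * cis (real n * t)) + of_real r * cis t))"
proof (rule property_Cn_perturbed_circle)
  fix t show "c + of_real e * cis (real n * (t + 2 * pi / real n)) = c + of_real e * cis (real n * t)"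
    using n by (simp add: distrib_left cis_mult[symmetric])
next
  fix s t :: real
  define u v a where "u = (s + t) / 2" and "v = (s - t) / 2" and "a = pi / real n"
  assume d: "dist (c + of_real e * cis (real n * s) + of_real r * cis s)
      (c + of_real e * cis (real n * t) + of_real r * cis t) = 2 * r * sin (pi / real n)"
  have half: "(real n * s - real n * t) / 2 = real n * v" "(real n * s + real n * t) / 2 = real n * u"
    by (simp_all add: u_def v_def algebra_simps)
  define S where "S = sin (real n * v)"
  define w where "w = real n * u - u"
  have w: "real n * u = u + w" by (simp add: w_def)
  have "(c + of_real e * cis (real n * s) + of_real r * cis s)
      - (c + of_real e * cis (real n * t) + of_real r * cis t)
      = of_real e * (cis (real n * s) - cis (real n * t)) + of_real r * (cis s - cis t)"
    by (simp add: algebra_simps)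
  also have "\<dots> = 2 * \<i> * cis u * (of_real (r * sin v) + of_real (e * S) * cis w)"
    unfolding cis_diff half unfolding w u_def[symmetric] v_def[symmetric] S_def[symmetric]
    by (simp add: cis_mult[symmetric] algebra_simps S_def w)
  finally have "norm (2 * \<i> * cis u * (of_real (r * sin v) + of_real (e * S) * cis w)) = 2 * (r * sin a)"
    using d by (simp add: dist_norm a_def)
  then have "norm (of_real (r * sin v) + of_real (e * S) * cis w) = r * sin a"
    by (simp add: norm_mult del: of_real_mult)
  then have "(r * sin a) ^ 2 = norm (of_real (r * sin v) + of_real (e * S) * cis w) ^ 2"
    by simp
  also have "\<dots> = (r * sin v + e * S * cos w) ^ 2 + (e * S * sin w) ^ 2"
    unfolding cmod_power2 by simp
  also have "\<dots> = r^2 * sin v ^ 2 + S * e * (2 * r * sin v * cos w + e * S)"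
    using sin_cos_squared_add[of w] by algebra
  finally have "r^2 * (sin (v - a) * sin (v + a)) = - (S * (e * (2 * r * sin v * cos w + e * S)))"
    unfolding sin_sq_diff[symmetric] by (simp add: algebra_simps power_mult_distrib)
  then have "r^2 * \<bar>sin (v - a) * sin (v + a)\<bar> = \<bar>S\<bar> * (e * \<bar>2 * r * sin v * cos w + e * S\<bar>)"
    using e by (metis abs_minus abs_mult abs_of_nonneg zero_le_power2)
  also have "\<dots> \<le> \<bar>S\<bar> * (e * (2 * r + real n * e))"
  proof -
    have "\<bar>sin v * cos w\<bar> \<le> 1" by (simp add: abs_mult mult_le_one)
    then have "2 * r * \<bar>sin v * cos w\<bar> \<le> 2 * r * 1" using r by (intro mult_left_mono) auto
    moreover have "\<bar>S\<bar> \<le> real n"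
      using n abs_sin_le_one[of "real n * v"] unfolding S_def by linarith
    then have "e * \<bar>S\<bar> \<le> e * real n" using e by (intro mult_left_mono)
    moreover have "\<bar>2 * r * sin v * cos w\<bar> = 2 * r * \<bar>sin v * cos w\<bar>" "\<bar>e * S\<bar> = e * \<bar>S\<bar>"
      using r e by (simp_all add: abs_mult)
    ultimately have "\<bar>2 * r * sin v * cos w + e * S\<bar> \<le> 2 * r + real n * e"
      using abs_triangle_ineq[of "2 * r * sin v * cos w" "e * S"] mult.commute[of e "real n"]
      by linarith
    then show ?thesis using e by (intro mult_left_mono) auto
  qed
  finally have main: "r^2 * \<bar>sin (v - a) * sin (v + a)\<bar> \<le> \<bar>S\<bar> * (e * (2 * r + real n * e))" .
  define P where "P = \<bar>sin (v - a) * sin (v + a)\<bar>"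
  have "sin (2 * a) > 0"
  proof (rule sin_gt_zero)
    have "2 * pi < real n * pi" using n by simp
    then show "2 * a < pi" using n by (simp add: a_def field_simps)
  qed (use n in \<open>simp add: a_def\<close>)
  then have "sin (2 * a) * (r^2 * P) \<le> sin (2 * a) * (\<bar>S\<bar> * (e * (2 * r + real n * e)))"
    using main by (intro mult_left_mono) (auto simp: P_def)
  also have "\<dots> = (sin (2 * a) * \<bar>S\<bar>) * (e * (2 * r + real n * e))" by simp
  also have "\<dots> \<le> (2 * real n * P) * (e * (2 * r + real n * e))"
    using abs_sin_n_le_product[OF n, of v] e r
    by (intro mult_right_mono) (auto simp: P_def a_def S_def)
  finally have "P * (sin (2 * a) * r^2 - 2 * real n * (e * (2 * r + real n * e))) \<le> 0"
    by (simp add: algebra_simps)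
  moreover have "P \<ge> 0" by (simp add: P_def)
  ultimately have "P = 0"
    using small by (auto simp: a_def mult_le_0_iff)
  then show "sin ((s - t) / 2 - pi / real n) = 0 \<or> sin ((s - t) / 2 + pi / real n) = 0"
    by (auto simp: P_def v_def a_def)
qed (use n r in auto)

lemma regular_simple_closed_epitrochoid:
  assumes n: "n \<ge> 3" and r: "r > 0" and e: "e \<ge> 0" and small: "real n * e < r"
  shows "regular_simple_closed_curve k
    (range (\<lambda>t. (c + of_real e * cis (real n * t)) + of_real r * cis t))"
proof (rule regular_simple_closed_perturbed_circle)
  show "derivative_tower (\<lambda>t. c + of_real e * cis (real n * t))
      (\<lambda>j t. c * (\<i> * of_real 0) ^ j * cis (0 * t)
        + of_real e * (\<i> * of_real (real n)) ^ j * cis (real n * t))"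
    using derivative_tower_add[OF derivative_tower_cis[of c 0]
        derivative_tower_cis[of "of_real e" "real n"]] by simp
  show "norm (c * (\<i> * of_real 0) ^ 1 * cis (0 * t)
        + of_real e * (\<i> * of_real (real n)) ^ 1 * cis (real n * t)) < r" for t
    using small e by (simp add: norm_mult mult.commute)
  show "norm (c + of_real e * cis (real n * s) - (c + of_real e * cis (real n * t)))
      \<le> 2 * (real n * e) * \<bar>sin ((s - t) / 2)\<bar>" for s t
  proof -
    have half: "(real n * s - real n * t) / 2 = real n * ((s - t) / 2)" by (simp add: algebra_simps)
    have "c + of_real e * cis (real n * s) - (c + of_real e * cis (real n * t))
        = of_real e * (cis (real n * s) - cis (real n * t))"
      by (simp add: algebra_simps)
    then have "norm (c + of_real e * cis (real n * s) - (c + of_real e * cis (real n * t)))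
        = 2 * e * \<bar>sin (real n * ((s - t) / 2))\<bar>"
      unfolding cis_diff half using e by (simp add: norm_mult)
    also have "\<dots> \<le> 2 * e * (real n * \<bar>sin ((s - t) / 2)\<bar>)"
      using e by (intro mult_left_mono abs_sin_of_nat_mult_le) auto
    finally show ?thesis by (simp add: mult_ac)
  qed
  show "c + of_real e * cis (real n * (t + 2 * pi)) = c + of_real e * cis (real n * t)" for t
    using cis_add_int_2pi[of "real n * t" "int n"] by (simp add: distrib_left)
qed (use small in auto)

text \<open>The two frequencies \<open>1\<close> and \<open>n\<close> are congruent modulo \<open>n - 1\<close>, hence the curve has an
  \<open>(n - 1)\<close>-fold rotational symmetry.\<close>

lemma epitrochoid_not_sphere:
  assumes n: "n \<ge> 3" and r: "r > 0" and e: "e > 0" and R: "R > 0"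
  shows "range (\<lambda>t. of_real e * cis (real n * t) + of_real r * cis t) \<noteq> sphere c R"
proof (rule not_sphere_if_rotation_invariant[OF _ _ _ _ _ _ R])
  define \<gamma> where "\<gamma> = (\<lambda>t. of_real e * cis (real n * t) + of_real r * cis t)"
  define p where "p = pi / real (n - 1)"
  have np: "real n * p = p + pi"
    using n by (simp add: p_def field_simps of_nat_diff)
  have pb: "0 < p" "p < pi" 
    using n by (auto simp: p_def field_simps)
  show "cis (2 * p) \<noteq> 1"
  proof
    assume "cis (2 * p) = 1"
    then have "cos (2 * p) = 1" by (simp add: complex_eq_iff)
    then have "sin p = 0" using cos_double_sin[of p] by simp
    with sin_gt_zero[OF pb] show False by simp
  qed
  show "norm (cis (2 * p)) = 1" by simp
  show "cis (2 * p) * x \<in> range \<gamma>" if "x \<in> range \<gamma>" for x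
  proof -
    obtain t where t: "x = \<gamma> t" using \<open>x \<in> range \<gamma>\<close> by blast
    have "real n * (t + 2 * p) = real n * t + 2 * p + 2 * pi"
      using np by (simp add: algebra_simps)
    then have "cis (real n * (t + 2 * p)) = cis (real n * t) * cis (2 * p)"
      by (simp add: cis_mult[symmetric])
    then have "\<gamma> (t + 2 * p) = cis (2 * p) * x"
      by (simp add: \<gamma>_def t cis_mult[symmetric] algebra_simps)
    then show ?thesis by (metis rangeI)
  qed
  show "\<gamma> 0 \<in> range \<gamma>" "\<gamma> p \<in> range \<gamma>" by blast+
  have "\<gamma> 0 = of_real (e + r)" by (simp add: \<gamma>_def)
  moreover have "cis (real n * p) = - cis p"
    unfolding np by (simp add: cis_mult[symmetric])
  then have "\<gamma> p = of_real (r - e) * cis p"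
    by (simp add: \<gamma>_def algebra_simps)
  ultimately have "norm (\<gamma> 0) = e + r" "norm (\<gamma> p) = \<bar>r - e\<bar>"
    using e r by (simp_all add: norm_mult del: of_real_add of_real_diff)
  then show "norm (\<gamma> 0) \<noteq> norm (\<gamma> p)" using e r by auto
qed

section \<open>A smooth curve of constant width\<close>

text \<open>This traces a deltoid twice as \<open>t\<close> runs through one period \<open>2 * pi\<close>. Its velocity is
  \<open>8 * e * cos (3 * t)\<close> times \<open>\<i> * cis t\<close>, so it is orthogonal to \<open>cis t\<close>. Therefore \<open>cis t\<close> is
  normal to the curve \<open>deltoid_centre e t + r * cis t\<close>, which has constant width \<open>2 * r\<close>.\<close>

definition deltoid_centre :: "real \<Rightarrow> real \<Rightarrow> complex" where
  "deltoid_centre e t = of_real e * cis (4 * t) + of_real (- 2 * e) * cis (- 2 * t)"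

lemma deltoid_centre_diff:
  "deltoid_centre e s - deltoid_centre e t = 2 * \<i> * of_real (4 * e * sin ((s - t) / 2) * cos ((s - t) / 2))
    * (of_real (2 * cos ((s - t) / 2) ^ 2 - 1) * cis (2 * (s + t)) + cis (- (s + t)))"
proof -
  define v where "v = (s - t) / 2"
  have half: "(4 * s - 4 * t) / 2 = 2 * (2 * v)" "(4 * s + 4 * t) / 2 = 2 * (s + t)"
    "(- 2 * s - - 2 * t) / 2 = - (2 * v)" "(- 2 * s + - 2 * t) / 2 = - (s + t)"
    by (simp_all add: v_def field_simps)
  have "deltoid_centre e s - deltoid_centre e t
      = of_real e * (cis (4 * s) - cis (4 * t)) - 2 * of_real e * (cis (- 2 * s) - cis (- 2 * t))"
    by (simp add: deltoid_centre_def algebra_simps)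
  also have "\<dots> = 2 * \<i> * of_real e * (of_real (sin (2 * (2 * v))) * cis (2 * (s + t))
      + 2 * of_real (sin (2 * v)) * cis (- (s + t)))"
    unfolding cis_diff half sin_minus by (simp add: algebra_simps)
  also have "\<dots> = 2 * \<i> * of_real (4 * e * sin v * cos v)
    * (of_real (2 * cos v ^ 2 - 1) * cis (2 * (s + t)) + cis (- (s + t)))"
    unfolding sin_double[of "2 * v"] cos_double_cos sin_double by (simp add: algebra_simps)
  finally show ?thesis by (simp only: v_def)
qed

lemma regular_simple_closed_rounded_deltoid:
  assumes e: "e > 0" and small: "8 * e < r"
  shows "regular_simple_closed_curve k (range (\<lambda>t. deltoid_centre e t + of_real r * cis t))"
proof (rule regular_simple_closed_perturbed_circle)
  show "derivative_tower (deltoid_centre e)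
      (\<lambda>j t. of_real e * (\<i> * of_real 4) ^ j * cis (4 * t)
        + of_real (- 2 * e) * (\<i> * of_real (- 2)) ^ j * cis (- 2 * t))"
    unfolding deltoid_centre_def by (intro derivative_tower_add derivative_tower_cis)
  show "norm (of_real e * (\<i> * of_real 4) ^ 1 * cis (4 * t)
        + of_real (- 2 * e) * (\<i> * of_real (- 2)) ^ 1 * cis (- 2 * t)) < r" for t
  proof -
    have "norm (of_real e * (\<i> * of_real 4) ^ 1 * cis (4 * t)) = 4 * e"
      "norm (of_real (- 2 * e) * (\<i> * of_real (- 2)) ^ 1 * cis (- 2 * t)) = 4 * e"
      using e by (simp_all add: norm_mult)
    then show ?thesis using small norm_triangle_ineq by (smt (verit))
  qed
  show "norm (deltoid_centre e s - deltoid_centre e t) \<le> 2 * (8 * e) * \<bar>sin ((s - t) / 2)\<bar>" for s t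
  proof -
    define C where "C = cos ((s - t) / 2)"
    have C: "\<bar>C\<bar> \<le> 1" by (simp add: C_def)
    have "C ^ 2 \<le> 1" using C by (simp add: abs_square_le_1)
    then have C2: "\<bar>2 * C ^ 2 - 1\<bar> \<le> 1" by (simp add: abs_le_iff)
    have "norm (of_real (2 * C ^ 2 - 1) * cis (2 * (s + t)) + cis (- (s + t))) \<le> \<bar>2 * C ^ 2 - 1\<bar> + 1"
      by (rule norm_triangle_le) (simp add: norm_mult del: of_real_diff of_real_mult)
    with C2 have b: "norm (of_real (2 * C ^ 2 - 1) * cis (2 * (s + t)) + cis (- (s + t))) \<le> 2"
      by linarith
    have "norm (deltoid_centre e s - deltoid_centre e t) = 8 * e * \<bar>sin ((s - t) / 2)\<bar> * (\<bar>C\<bar> *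
        norm (of_real (2 * C ^ 2 - 1) * cis (2 * (s + t)) + cis (- (s + t))))"
      unfolding deltoid_centre_diff C_def[symmetric] norm_mult norm_of_real
      using e by (simp add: abs_mult)
    also have "\<dots> \<le> 8 * e * \<bar>sin ((s - t) / 2)\<bar> * (1 * 2)"
      using b C e by (intro mult_left_mono mult_mono) auto
    finally show ?thesis by simp
  qed
  show "deltoid_centre e (t + 2 * pi) = deltoid_centre e t" for t
    using cis_add_int_2pi[of "4 * t" 4] cis_add_int_2pi[of "- 2 * t" "- 2"]
    by (simp add: deltoid_centre_def algebra_simps)
qed (use small in auto)

text \<open>Since the diameters are double normals, the perturbation affects the length of a chord only to
  second order in \<open>C = cos ((s - t) / 2)\<close>: the chord has half-length \<open>\<bar>S\<bar> * norm Z\<close> with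
  \<open>S\<^sup>2 = 1 - C\<^sup>2\<close>, while \<open>norm Z\<close> exceeds \<open>r\<close> only by a small multiple of \<open>C\<^sup>2\<close>. All
  chords other than the diameters are therefore shorter than \<open>2 * r\<close>.\<close>

lemma property_C2_rounded_deltoid:
  assumes e: "e > 0" and small: "16 * r * e + 64 * e ^ 2 < r ^ 2" and r: "r > 0"
  shows "property_Cn 2 (2 * r) (range (\<lambda>t. deltoid_centre e t + of_real r * cis t))"
proof -
  have "property_Cn 2 (2 * r * sin (pi / real 2)) (range (\<lambda>t. deltoid_centre e t + of_real r * cis t))"
  proof (rule property_Cn_perturbed_circle)
    show "deltoid_centre e (t + 2 * pi / real 2) = deltoid_centre e t" for t
      using cis_add_int_2pi[of "4 * t" 2] cis_add_int_2pi[of "- 2 * t" "- 1"]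
      by (simp add: deltoid_centre_def algebra_simps)
  next
    fix s t :: real
    assume d: "dist (deltoid_centre e s + of_real r * cis s) (deltoid_centre e t + of_real r * cis t)
        = 2 * r * sin (pi / real 2)"
    define u v where "u = (s + t) / 2" and "v = (s - t) / 2"
    define C S where "C = cos v" and "S = sin v"
    have st: "2 * (s + t) = u + 3 * u" "- (s + t) = u - 3 * u" by (simp_all add: u_def field_simps)
    define Z where "Z = of_real r + of_real (4 * e * C) * (of_real (2 * C ^ 2 - 1) * cis (3 * u) + cis (- (3 * u)))"
    have "(deltoid_centre e s + of_real r * cis s) - (deltoid_centre e t + of_real r * cis t)
        = (deltoid_centre e s - deltoid_centre e t) + of_real r * (cis s - cis t)"
      by (simp add: algebra_simps)
    also have "\<dots> = 2 * \<i> * of_real S * cis u * Z"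
      unfolding deltoid_centre_diff cis_diff u_def[symmetric] v_def[symmetric] C_def[symmetric]
        S_def[symmetric] st
      unfolding diff_conv_add_uminus[of u] cis_mult[symmetric] Z_def
      by (simp add: algebra_simps)
    finally have "norm (2 * \<i> * of_real S * cis u * Z) = 2 * r"
      using d by (simp add: dist_norm)
    then have "r = \<bar>S\<bar> * norm Z" by (simp add: norm_mult)
    then have "r ^ 2 = S ^ 2 * norm Z ^ 2" by (simp add: power_mult_distrib)
    also have "norm Z ^ 2 = (r + 8 * e * C ^ 3 * cos (3 * u)) ^ 2 + (8 * e * C * S ^ 2 * sin (3 * u)) ^ 2"
    proof -
      have "Re Z = r + 8 * e * C ^ 3 * cos (3 * u)"
        by (simp add: Z_def algebra_simps power2_eq_square power3_eq_cube)
      moreover have "Im Z = 8 * e * C * (C ^ 2 - 1) * sin (3 * u)"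
        by (simp add: Z_def algebra_simps)
      moreover have "C ^ 2 - 1 = - (S ^ 2)"
        by (simp add: C_def S_def cos_squared_eq)
      ultimately show ?thesis unfolding cmod_power2 by (simp add: power_mult_distrib)
    qed
    also have "\<dots> \<le> r ^ 2 + C ^ 2 * (16 * r * e + 64 * e ^ 2)"
    proof -
      have b: "C ^ 2 \<le> 1" "S ^ 2 \<le> 1" "\<bar>C * cos (3 * u)\<bar> \<le> 1"
        unfolding C_def S_def by (auto simp: abs_square_le_1 abs_mult mult_le_one)
      have "C ^ 4 \<le> 1" "S ^ 4 \<le> 1"
        using b power_le_one[of "C ^ 2" 2] power_le_one[of "S ^ 2" 2] by (simp_all flip: power_mult)
      then have "C ^ 4 * cos (3 * u) ^ 2 + S ^ 4 * sin (3 * u) ^ 2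
          \<le> 1 * cos (3 * u) ^ 2 + 1 * sin (3 * u) ^ 2"
        by (intro add_mono mult_right_mono) auto
      then have "64 * e ^ 2 * (C ^ 4 * cos (3 * u) ^ 2 + S ^ 4 * sin (3 * u) ^ 2) \<le> 64 * e ^ 2 * 1"
        by (intro mult_left_mono) auto
      moreover have "16 * r * e * (C * cos (3 * u)) \<le> 16 * r * e * 1"
        using b r e by (intro mult_left_mono) auto
      ultimately have "C ^ 2 * (16 * r * e * (C * cos (3 * u))
          + 64 * e ^ 2 * (C ^ 4 * cos (3 * u) ^ 2 + S ^ 4 * sin (3 * u) ^ 2))
          \<le> C ^ 2 * (16 * r * e + 64 * e ^ 2)"
        by (intro mult_left_mono) auto
      moreover have "(r + 8 * e * C ^ 3 * cos (3 * u)) ^ 2 + (8 * e * C * S ^ 2 * sin (3 * u)) ^ 2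
          = r ^ 2 + C ^ 2 * (16 * r * e * (C * cos (3 * u))
          + 64 * e ^ 2 * (C ^ 4 * cos (3 * u) ^ 2 + S ^ 4 * sin (3 * u) ^ 2))"
        by algebra
      ultimately show ?thesis by simp
    qed
    finally have "r ^ 2 \<le> S ^ 2 * (r ^ 2 + C ^ 2 * (16 * r * e + 64 * e ^ 2))"
      by (simp add: mult_left_mono)
    moreover have "S ^ 2 = 1 - C ^ 2" by (simp add: C_def S_def sin_squared_eq)
    moreover define K where "K = 16 * r * e + 64 * e ^ 2"
    ultimately have "C ^ 2 * (r ^ 2 - K) + C ^ 2 * C ^ 2 * K \<le> 0"
      by (simp add: algebra_simps)
    moreover have "K \<ge> 0" using r e by (simp add: K_def)
    then have "C ^ 2 * C ^ 2 * K \<ge> 0" by simp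
    ultimately have "C ^ 2 * (r ^ 2 - K) \<le> 0" by linarith
    then have "C = 0" using small by (auto simp: K_def mult_le_0_iff)
    then show "sin ((s - t) / 2 - pi / real 2) = 0 \<or> sin ((s - t) / 2 + pi / real 2) = 0"
      by (simp add: sin_diff C_def v_def)
  qed (use r in auto)
  then show ?thesis by simp
qed

text \<open>The frequencies \<open>1\<close>, \<open>4\<close> and \<open>-2\<close> are congruent modulo \<open>3\<close>, which yields a threefold
  rotational symmetry.\<close>

lemma rounded_deltoid_not_sphere:
  assumes e: "e > 0" and r: "r > e" and R: "R > 0"
  shows "range (\<lambda>t. deltoid_centre e t + of_real r * cis t) \<noteq> sphere c R"
proof (rule not_sphere_if_rotation_invariant[OF _ _ _ _ _ _ R])
  define \<gamma> where "\<gamma> = (\<lambda>t. deltoid_centre e t + of_real r * cis t)"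
  define p where "p = pi / 3"
  show "cis (2 * p) \<noteq> 1"
  proof
    assume "cis (2 * p) = 1"
    then have "cos (2 * p) = 1" by (simp add: complex_eq_iff)
    then have "sin p = 0" using cos_double_sin[of p] by simp
    with sin_gt_zero[of p] show False by (simp add: p_def)
  qed
  show "norm (cis (2 * p)) = 1" by simp
  show "cis (2 * p) * x \<in> range \<gamma>" if "x \<in> range \<gamma>" for x
  proof -
    obtain t where t: "x = \<gamma> t" using \<open>x \<in> range \<gamma>\<close> by blast
    have a: "4 * (t + 2 * p) = 4 * t + 2 * p + of_int 1 * (2 * pi)" "- 2 * (t + 2 * p) = - 2 * t + 2 * p + of_int (- 1) * (2 * pi)"
      by (simp_all add: p_def)
    have "\<gamma> (t + 2 * p) = cis (2 * p) * x"
      unfolding \<gamma>_def t deltoid_centre_def a cis_add_int_2pi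
      unfolding cis_mult[symmetric] by (simp add: algebra_simps)
    then show ?thesis by (metis rangeI)
  qed
  show "\<gamma> 0 \<in> range \<gamma>" "\<gamma> p \<in> range \<gamma>" by blast+
  have "\<gamma> 0 = of_real (r - e)" by (simp add: \<gamma>_def deltoid_centre_def)
  moreover have "\<gamma> p = of_real (r + e) * cis p"
  proof -
    have p: "4 * p = p + pi" "- 2 * p = p + - pi" by (simp_all add: p_def)
    have "cis (- pi) = - 1" by (simp add: complex_eq_iff)
    then have "cis (4 * p) = - cis p" "cis (- 2 * p) = - cis p"
      unfolding p cis_mult[symmetric] by simp_all
    then show ?thesis unfolding \<gamma>_def deltoid_centre_def by (simp add: algebra_simps)
  qed
  ultimately have "norm (\<gamma> 0) = \<bar>r - e\<bar>" "norm (\<gamma> p) = r + e"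
    using e r by (simp_all add: norm_mult del: of_real_add of_real_diff)
  then show "norm (\<gamma> 0) \<noteq> norm (\<gamma> p)" using e r by auto
qed

lemma exists_noncircular_property_Cn:
  assumes n: "n \<ge> 2" and D: "D > 0"
  shows "\<exists>\<Gamma>. regular_simple_closed_curve \<infinity> \<Gamma> \<and>
    \<not> (\<exists>c r. r > 0 \<and> \<Gamma> = sphere c r) \<and> property_Cn n D \<Gamma>"
proof (cases "n = 2")
  case True
  define r e where "r = D / 2" and "e = r / 32"
  have r: "r > 0" using D by (simp add: r_def)
  then have e: "e > 0" "8 * e < r" "e < r" by (simp_all add: e_def)
  have "16 * r * e + 64 * e ^ 2 < r ^ 2"
    using r by (simp add: e_def power2_eq_square)
  then have "property_Cn 2 D (range (\<lambda>t. deltoid_centre e t + of_real r * cis t))"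
    using property_C2_rounded_deltoid[of e r] e r by (simp add: r_def)
  then show ?thesis
    using regular_simple_closed_rounded_deltoid[of e r] rounded_deltoid_not_sphere[of e r] e True
    by blast
next
  case False
  with n have n3: "n \<ge> 3" by simp
  define r where "r = D / (2 * sin (pi / real n))"
  have s: "sin (pi / real n) > 0"
    using n by (intro sin_gt_zero) (auto simp: field_simps)
  have s2: "sin (2 * (pi / real n)) > 0"
  proof (rule sin_gt_zero)
    have "2 * pi < real n * pi" using n3 by simp
    then show "2 * (pi / real n) < pi" using n3 by (simp add: field_simps)
  qed (use n in simp)
  have r: "r > 0" using D s by (simp add: r_def)
  have D: "2 * r * sin (pi / real n) = D" using s by (simp add: r_def)
  have "((\<lambda>e. 2 * real n * (e * (2 * r + real n * e))) \<longlongrightarrow> 2 * real n * (0 * (2 * r + real n * 0))) (at_right 0)"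
    "((\<lambda>e. real n * e) \<longlongrightarrow> real n * 0) (at_right 0)"
    by (intro tendsto_intros)+
  then have "eventually (\<lambda>e. 2 * real n * (e * (2 * r + real n * e)) < sin (2 * (pi / real n)) * r ^ 2) (at_right 0)"
    "eventually (\<lambda>e. real n * e < r) (at_right 0)"
    using r s2 by (auto intro!: order_tendstoD(2))
  then have "eventually (\<lambda>e. 0 < e \<and> real n * e < r \<and>
      2 * real n * (e * (2 * r + real n * e)) < sin (2 * (pi / real n)) * r ^ 2) (at_right 0)"
    using eventually_at_right_less[of "0::real"] by eventually_elim auto
  then obtain e where e: "0 < e" "real n * e < r"
      "2 * real n * (e * (2 * r + real n * e)) < sin (2 * (pi / real n)) * r ^ 2"
    using eventually_happens'[OF trivial_limit_at_right_real] by blast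
  then show ?thesis
    using property_Cn_epitrochoid[OF n3 r, of e 0] regular_simple_closed_epitrochoid[OF n3 r, of e \<infinity> 0]
      epitrochoid_not_sphere[OF n3 r, of e]
    unfolding D by (intro exI[of _ "range (\<lambda>t. of_real e * cis (real n * t) + of_real r * cis t)"]) auto
qed

section \<open>Diameters and inscribed squares\<close>

lemma inner_deriv_eq_0_if_max_norm:
  fixes f :: "real \<Rightarrow> 'a::real_inner"
  assumes f: "(f has_vector_derivative f') (at t)"
    and max: "\<And>s. norm (f s - q) \<le> norm (f t - q)"
  shows "f' \<bullet> (f t - q) = 0"
proof -
  have "((\<lambda>s. f s - q) has_vector_derivative f' - 0) (at t)"
    by (intro has_vector_derivative_diff f has_vector_derivative_const)
  then have d: "((\<lambda>s. f s - q) has_derivative (\<lambda>h. h *\<^sub>R f')) (at t)"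
    by (simp add: has_vector_derivative_def)
  have "((\<lambda>s. (f s - q) \<bullet> (f s - q)) has_real_derivative 2 * (f' \<bullet> (f t - q))) (at t)"
    unfolding has_field_derivative_def
    by (rule derivative_eq_intros d refl)+ (auto simp: inner_commute algebra_simps)
  moreover have "(f s - q) \<bullet> (f s - q) \<le> (f t - q) \<bullet> (f t - q)" for s
    using max[of s] by (simp add: power_mono flip: power2_norm_eq_inner)
  ultimately have "2 * (f' \<bullet> (f t - q)) = 0"
    by (intro DERIV_local_max[of _ _ t 1]) auto
  then show ?thesis by simp
qed

lemma orthogonal_eq_plus_minus_normal:
  assumes "norm g = 1" "norm w = d" "g \<bullet> w = (0::real)"
  shows "w = of_real d * (\<i> * g) \<or> w = - (of_real d * (\<i> * g))"
proof -
  define l where "l = Re g * Im w - Im g * Re w"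
  have g: "Re g ^ 2 + Im g ^ 2 = 1" using assms(1) by (simp add: cmod_def)
  have o: "Re g * Re w + Im g * Im w = 0" using assms(3) by (simp add: inner_complex_def)
  have "d ^ 2 = Re w ^ 2 + Im w ^ 2" using cmod_power2[of w] assms(2) by simp
  then have "l ^ 2 = d ^ 2" using g o unfolding l_def by algebra
  then have "l = d \<or> l = - d" by (simp add: power2_eq_iff)
  moreover have "Re w = - (l * Im g)" "Im w = l * Re g"
    using g o unfolding l_def by algebra+
  ultimately show ?thesis by (auto simp: complex_eq_iff)
qed

lemma orthogonal_to_basis_eq_0:
  assumes "N \<noteq> 0" "z \<bullet> N = 0" "z \<bullet> (\<i> * N) = 0"
  shows "z = (0::complex)"
proof -
  have "Re z * Re N + Im z * Im N = 0" "Im z * Re N - Re z * Im N = 0"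
    using assms(2,3) by (simp_all add: inner_complex_def)
  then have "Re z * (Re N ^ 2 + Im N ^ 2) = 0" "Im z * (Re N ^ 2 + Im N ^ 2) = 0"
    by algebra+
  moreover have "Re N ^ 2 + Im N ^ 2 \<noteq> 0"
    using assms(1) by (metis cmod_power2 norm_eq_zero power_eq_0_iff)
  ultimately show ?thesis by (auto simp: complex_eq_iff)
qed

text \<open>A square with edge \<open>D / sqrt 2\<close> has diagonal \<open>D\<close>; multiplication of the half-diagonal at \<open>x\<close>
  by \<open>\<i>\<close> leads to the other diagonal.\<close>

lemma square_vertices:
  assumes V: "regular_ngon 4 (D / sqrt 2) V" and D: "D > 0" and x: "x \<in> V"
  obtains c where "norm (x - c) = D / 2" "c - (x - c) \<in> V"
    "c + \<i> * (x - c) \<in> V" "c - \<i> * (x - c) \<in> V"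
proof -
  have s: "2 * (D / 2) * sin (pi / real 4) = D / sqrt 2"
    by (simp add: sin_45 field_simps)
  obtain \<theta> where \<theta>: "V = range (\<lambda>k::int. x - of_real (D / 2) * cis \<theta>
      + of_real (D / 2) * cis (\<theta> + 2 * pi * of_int k / real 4))"
    using regular_ngon_at[of 4 "D / 2" V x] V x D unfolding s by auto
  define c where "c = x - of_real (D / 2) * cis \<theta>"
  have xc: "x - c = of_real (D / 2) * cis \<theta>" by (simp add: c_def)
  have V': "c + (x - c) * cis (2 * pi * of_int k / real 4) \<in> V" for k :: int
    unfolding \<theta> xc cis_mult[symmetric] c_def by (auto simp: mult_ac)
  show thesis
  proof
    show "norm (x - c) = D / 2" using D by (simp add: xc norm_mult)
    show "c - (x - c) \<in> V" using V'[of 2] by simp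
    have "2 * pi * of_int 1 / real 4 = pi / 2" "2 * pi * of_int (- 1) / real 4 = - (pi / 2)"
      by simp_all
    then show "c + \<i> * (x - c) \<in> V" "c - \<i> * (x - c) \<in> V"
      using V'[of 1] V'[of "- 1"] by (simp_all add: mult.commute)
  qed
qed

lemma compact_range_periodic:
  fixes f :: "real \<Rightarrow> 'a::topological_space"
  assumes per: "\<And>t. f (t + T) = f t" and T: "T > 0" and cont: "continuous_on UNIV f"
  shows "compact (range f)"
proof -
  have "range f = f ` {0..T}"
  proof
    show "range f \<subseteq> f ` {0..T}"
    proof (rule image_subsetI)
      fix t
      define k where "k = \<lfloor>t / T\<rfloor>"
      have "of_int k \<le> t / T" "t / T < of_int k + 1" by (auto simp: k_def)
      then have "t + of_int (- k) * T \<in> {0..T}" using T by (auto simp: field_simps)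
      moreover have "f (t + of_int (- k) * T) = f t"
        by (rule periodic_int_shift[of f, OF per])
      ultimately show "f t \<in> f ` {0..T}" by (metis imageI)
    qed
  qed auto
  moreover have "compact (f ` {0..T})"
    using cont by (intro compact_continuous_image continuous_on_subset[OF cont]) auto
  ultimately show ?thesis by simp
qed

lemma norm_diff_le_if_property_C:
  assumes "property_C D \<Gamma>" "p \<in> \<Gamma>" "q \<in> \<Gamma>"
  shows "norm (p - q) \<le> D"
  using assms unfolding property_C_def by (metis less_eq_real_def)

lemma unique_antipode_if_property_C:
  assumes "property_C D \<Gamma>" "p \<in> \<Gamma>" "q \<in> \<Gamma>" "q' \<in> \<Gamma>" "norm (p - q) = D" "norm (p - q') = D"
  shows "q = q'"
  using assms unfolding property_C_def by metis

text \<open>The point farthest from \<open>\<gamma> t\<close> lies on the normal line at \<open>\<gamma> t\<close>, because the distance to it is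
  maximal at \<open>\<gamma> t\<close>. On which side it lies does not depend on \<open>t\<close>: each side is taken on a closed
  set of parameters, these two sets are disjoint because the farthest point is unique, and the line
  is connected.\<close>

lemma antipode_along_fixed_normal:
  fixes \<gamma> N :: "real \<Rightarrow> complex"
  assumes C: "property_C D (range \<gamma>)" and D: "D > 0" and cl: "closed (range \<gamma>)"
    and \<gamma>: "\<And>t. (\<gamma> has_vector_derivative of_real (v t) * g t) (at t)"
    and v: "\<And>t. v t \<noteq> 0"
    and g: "\<And>t. norm (g t) = 1" and cont: "continuous_on UNIV g"
  obtains s :: real where "s = 1 \<or> s = - 1" "\<And>t. \<gamma> t + of_real (s * D) * (\<i> * g t) \<in> range \<gamma>"
proof -
  define F where "F = (\<lambda>(s::real) t. \<gamma> t + of_real (s * D) * (\<i> * g t))"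
  define A where "A = (\<lambda>s. {t. F s t \<in> range \<gamma>})"
  have \<gamma>c: "continuous_on UNIV \<gamma>"
    using has_vector_derivative_continuous[OF \<gamma>] by (simp add: continuous_at_imp_continuous_on)
  have "closed (A s)" for s
  proof -
    have "continuous_on UNIV (F s)"
      unfolding F_def by (intro continuous_intros \<gamma>c cont)
    then have "closed (F s -` range \<gamma>)"
      using cl by (simp add: continuous_on_closed_vimage)
    then show ?thesis by (simp add: A_def vimage_def)
  qed
  moreover have "A 1 \<inter> A (- 1) = {}"
  proof (rule ccontr)
    assume "A 1 \<inter> A (- 1) \<noteq> {}"
    then obtain t where "F 1 t \<in> range \<gamma>" "F (- 1) t \<in> range \<gamma>" by (auto simp: A_def)
    moreover have "norm (\<gamma> t - F 1 t) = D" "norm (\<gamma> t - F (- 1) t) = D"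
      using D g by (simp_all add: F_def norm_mult)
    ultimately have "F 1 t = F (- 1) t"
      using unique_antipode_if_property_C[OF C] by blast
    then have "of_real (2 * D) * (\<i> * g t) = 0" by (simp add: F_def algebra_simps)
    then show False using D g[of t] by auto
  qed
  moreover have "A 1 \<union> A (- 1) = UNIV"
  proof -
    have "t \<in> A 1 \<union> A (- 1)" for t
    proof -
      obtain y where y: "y \<in> range \<gamma>" "norm (\<gamma> t - y) = D"
        using C unfolding property_C_def by blast
      have "(of_real (v t) * g t) \<bullet> (\<gamma> t - y) = 0"
        using y norm_diff_le_if_property_C[OF C _ y(1)]
        by (intro inner_deriv_eq_0_if_max_norm[OF \<gamma>]) auto
      then have "v t * (g t \<bullet> (y - \<gamma> t)) = 0"
        by (simp add: inner_complex_def algebra_simps)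
      then have "g t \<bullet> (y - \<gamma> t) = 0" using v by simp
      moreover have "norm (y - \<gamma> t) = D" using y by (simp add: norm_minus_commute)
      ultimately have "y - \<gamma> t = of_real D * (\<i> * g t) \<or> y - \<gamma> t = - (of_real D * (\<i> * g t))"
        using orthogonal_eq_plus_minus_normal g by blast
      then have "y = F 1 t \<or> y = F (- 1) t"
        by (auto simp: F_def algebra_simps)
      with y(1) have "F 1 t \<in> range \<gamma> \<or> F (- 1) t \<in> range \<gamma>" by metis
      then show ?thesis by (simp add: A_def)
    qed
    then show ?thesis by blast
  qed
  ultimately have "A 1 = UNIV \<or> A (- 1) = UNIV"
    using connected_closed[of "UNIV::real set"] by (smt (verit) connected_UNIV inf_top_right sup_bot.right_neutral sup_bot.left_neutral subset_UNIV order_refl)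
  then show thesis
    using that[of 1] that[of "- 1"] unfolding A_def F_def by blast
qed

text \<open>If a point \<open>q\<close> of the circle were missing, then so would be its antipode, and the line through
  both would separate \<open>\<Gamma>\<close> into two nonempty parts that the antipodal map exchanges.\<close>

lemma eq_sphere_if_antipodal:
  fixes \<Gamma> :: "complex set"
  assumes sub: "\<Gamma> \<subseteq> sphere c R" and conn: "connected \<Gamma>" and ne: "\<Gamma> \<noteq> {}"
    and anti: "\<And>p. p \<in> \<Gamma> \<Longrightarrow> 2 * c - p \<in> \<Gamma>"
  shows "\<Gamma> = sphere c R"
proof (rule ccontr)
  assume "\<Gamma> \<noteq> sphere c R"
  with sub obtain q where "q \<in> sphere c R" and qn: "q \<notin> \<Gamma>" by blast
  then have q: "norm (q - c) = R" by (simp add: dist_norm norm_minus_commute)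
  then have q': "2 * c - q \<notin> \<Gamma>" using anti[of "2 * c - q"] qn by auto
  define h where "h = (\<lambda>p. (\<i> * (q - c)) \<bullet> (p - c))"
  have nz: "h p \<noteq> 0" if p: "p \<in> \<Gamma>" for p
  proof
    assume h0: "h p = 0"
    have pR: "norm (p - c) = R" using sub p by (auto simp: dist_norm norm_minus_commute)
    show False
    proof (cases "R = 0")
      case True
      then show False using pR q qn p by simp
    next
      case False
      define g where "g = (1 / R) *\<^sub>R (\<i> * (q - c))"
      have "R > 0" using False pR norm_ge_zero[of "p - c"] by linarith
      then have "norm g = 1" using q by (simp add: g_def norm_mult)
      moreover have "g \<bullet> (p - c) = 0"
        using h0 unfolding g_def h_def by simp
      ultimately have "p - c = of_real R * (\<i> * g) \<or> p - c = - (of_real R * (\<i> * g))"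
        using orthogonal_eq_plus_minus_normal pR by blast
      moreover have "of_real R * (\<i> * g) = c - q"
        using False by (simp add: g_def scaleR_conv_of_real)
      ultimately have "p = 2 * c - q \<or> p = q" by (auto simp: algebra_simps)
      then show False using p qn q' by blast
    qed
  qed
  obtain p where p: "p \<in> \<Gamma>" using ne by blast
  have "h (2 * c - p) = - h p" by (simp add: h_def inner_complex_def algebra_simps)
  moreover have "connected (h ` \<Gamma>)"
    using conn unfolding h_def by (intro connected_continuous_image continuous_intros)
  ultimately have "0 \<in> h ` \<Gamma>"
    using p anti[OF p] by (smt (verit) connected_contains_Icc atLeastAtMost_iff imageI subsetD)
  then show False using nz by auto
qed

text \<open>Let \<open>m t\<close> be the midpoint of the diameter at \<open>\<gamma> t\<close> and \<open>g t\<close> the unit tangent. The diameter at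
  \<open>\<gamma> t\<close> is normal to \<open>\<Gamma>\<close> and of constant length, so \<open>m' t\<close> has no component along the
  diameter. The square at \<open>\<gamma> t\<close> has this diameter as a diagonal; its other diagonal, parallel to
  \<open>g t\<close>, also joins two points of \<open>\<Gamma>\<close> at maximal distance and has the same midpoint. For the
  same reason \<open>m' t\<close> has no component along \<open>g t\<close>. Hence \<open>m\<close> is constant. Two continuous
  derivatives of \<open>\<gamma>\<close> make \<open>g\<close>, and with it \<open>m\<close>, differentiable.\<close>

lemma sphere_if_property_C4_and_C:
  assumes D: "D > 0" and reg: "regular_simple_closed_curve 2 \<Gamma>"
    and C4: "property_Cn 4 (D / sqrt 2) \<Gamma>" and C: "property_C D \<Gamma>"
  shows "\<exists>c. \<Gamma> = sphere c (D / 2)"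
proof -
  obtain \<gamma> T where T: "T > 0" and per: "\<And>t. \<gamma> (t + T) = \<gamma> t"
    and smooth: "C_differentiable 2 \<gamma>" and nz: "\<And>t. vector_derivative \<gamma> (at t) \<noteq> 0"
    and \<Gamma>: "\<Gamma> = range \<gamma>"
    using reg unfolding regular_simple_closed_curve_def by blast
  define \<gamma>' where "\<gamma>' = (\<lambda>t. vector_derivative \<gamma> (at t))"
  have it: "iter_vector_derivative 0 \<gamma> = \<gamma>" "iter_vector_derivative 1 \<gamma> = \<gamma>'"
    by (simp_all add: iter_vector_derivative_def \<gamma>'_def)
  have "enat 0 < 2" "enat 1 < 2" by (simp_all add: numeral_eq_enat)
  then have "\<gamma> differentiable (at t)" and \<gamma>'d: "\<gamma>' differentiable (at t)" for t
    using smooth it unfolding C_differentiable_def by metis+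
  then have \<gamma>: "(\<gamma> has_vector_derivative \<gamma>' t) (at t)" for t
    by (simp add: vector_derivative_works \<gamma>'_def)
  have \<gamma>c: "continuous_on UNIV \<gamma>"
    using has_vector_derivative_continuous[OF \<gamma>] by (simp add: continuous_at_imp_continuous_on)
  have nz': "\<gamma>' t \<noteq> 0" for t using nz by (simp add: \<gamma>'_def)
  define g where "g = (\<lambda>t. inverse (norm (\<gamma>' t)) *\<^sub>R \<gamma>' t)"
  have gd: "g differentiable (at t)" for t
  proof -
    have "(norm \<circ> \<gamma>') differentiable (at t)"
      using \<gamma>'d nz' by (intro differentiable_chain_at differentiable_norm_at)
    then show ?thesis
      unfolding g_def using \<gamma>'d nz'
      by (intro differentiable_scaleR differentiable_inverse) (auto simp: o_def)
  qed
  define g' where "g' = (\<lambda>t. vector_derivative g (at t))"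
  have g': "(g has_vector_derivative g' t) (at t)" for t
    using gd by (simp add: g'_def vector_derivative_works)
  have g1: "norm (g t) = 1" for t using nz' by (simp add: g_def)
  have \<gamma>g: "\<gamma>' t = of_real (norm (\<gamma>' t)) * g t" for t
    using nz' by (simp add: g_def scaleR_conv_of_real)
  have gc: "continuous_on UNIV g"
    using has_vector_derivative_continuous[OF g'] by (simp add: continuous_at_imp_continuous_on)
  obtain s :: real where s: "s = 1 \<or> s = - 1" and sD: "\<And>t. \<gamma> t + of_real (s * D) * (\<i> * g t) \<in> range \<gamma>"
  proof (rule antipode_along_fixed_normal[OF C[unfolded \<Gamma>] D])
    show "closed (range \<gamma>)"
      using compact_range_periodic[OF per T \<gamma>c] by (rule compact_imp_closed)
    show "(\<gamma> has_vector_derivative of_real (norm (\<gamma>' t)) * g t) (at t)" for t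
      using \<gamma> \<gamma>g by metis
  qed (use nz' g1 gc in auto)
  define m where "m = (\<lambda>t. \<gamma> t + of_real (s * D / 2) * (\<i> * g t))"
  define m' where "m' = (\<lambda>t. \<gamma>' t + of_real (s * D / 2) * (\<i> * g' t))"
  have m: "(m has_vector_derivative m' t) (at t)" for t
    unfolding m_def m'_def
    by (intro has_vector_derivative_add \<gamma> has_vector_derivative_mult_right g')
  have sq: "\<gamma> t + of_real (s * D) * (\<i> * g t) = 2 * m t - \<gamma> t" for t
    by (simp add: m_def algebra_simps)
  have antipode: "2 * m t - \<gamma> t \<in> \<Gamma>" for t using sD sq \<Gamma> by metis
  have \<gamma>m: "\<gamma> t - m t = - (of_real (s * D / 2) * (\<i> * g t))" for t by (simp add: m_def)
  have diagonal: "m t + of_real (D / 2) * g t \<in> \<Gamma>" "m t - of_real (D / 2) * g t \<in> \<Gamma>" for t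
  proof -
    obtain V where V: "regular_ngon 4 (D / sqrt 2) V" "V \<subseteq> \<Gamma>" "\<gamma> t \<in> V"
      using C4 unfolding property_Cn_def inscribed_at_def \<Gamma> by blast
    obtain c where c: "norm (\<gamma> t - c) = D / 2" "c - (\<gamma> t - c) \<in> V"
        "c + \<i> * (\<gamma> t - c) \<in> V" "c - \<i> * (\<gamma> t - c) \<in> V"
      using square_vertices[OF V(1) D V(3)] .
    \<comment> \<open>The vertex opposite to \<open>\<gamma> t\<close> is at distance \<open>D\<close>, so it is the other end of the diameter.\<close>
    have "\<gamma> t - (c - (\<gamma> t - c)) = 2 * (\<gamma> t - c)" by simp
    then have "norm (\<gamma> t - (c - (\<gamma> t - c))) = D"
      using c(1) by (simp only: norm_mult) simp
    moreover have "\<gamma> t - (2 * m t - \<gamma> t) = 2 * (\<gamma> t - m t)" by simp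
    then have "norm (\<gamma> t - (2 * m t - \<gamma> t)) = D"
      using s D g1[of t] by (simp only: norm_mult \<gamma>m norm_minus_cancel) (auto simp: norm_mult)
    ultimately have "c - (\<gamma> t - c) = 2 * m t - \<gamma> t"
      using unique_antipode_if_property_C[OF C] antipode[of t] c(2) V \<Gamma> by blast
    then have "c = m t" by simp
    then have "m t + of_real (s * (D / 2)) * g t \<in> \<Gamma>" "m t - of_real (s * (D / 2)) * g t \<in> \<Gamma>"
      using c(3,4) V(2) unfolding \<gamma>m[of t, folded \<open>c = m t\<close>] \<open>c = m t\<close>
      by (auto simp: \<gamma>m algebra_simps)
    with s show "m t + of_real (D / 2) * g t \<in> \<Gamma>" "m t - of_real (D / 2) * g t \<in> \<Gamma>" by auto
  qed
  have "m' t = 0" for t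
  proof (rule orthogonal_to_basis_eq_0)
    have "g' t \<bullet> (g t - 0) = 0"
      using g1 by (intro inner_deriv_eq_0_if_max_norm[OF g']) simp
    then have gg': "g' t \<bullet> g t = 0" by simp
    show "g t \<noteq> 0" using g1[of t] by auto
    \<comment> \<open>The end \<open>p\<close> of the other diagonal moves within \<open>\<Gamma>\<close>, hence it stays within distance \<open>D\<close> of
      the opposite end \<open>q\<close> at time \<open>t\<close>, and this distance is attained at time \<open>t\<close>.\<close>
    define p where "p = (\<lambda>t. m t + of_real (D / 2) * g t)"
    have p: "(p has_vector_derivative m' t + of_real (D / 2) * g' t) (at t)" for t
      unfolding p_def by (intro has_vector_derivative_add m has_vector_derivative_mult_right g')
    define q where "q = m t - of_real (D / 2) * g t"
    have pq: "p t - q = of_real D * g t" by (simp add: p_def q_def)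
    have "norm (p s - q) \<le> norm (p t - q)" for s
    proof -
      have "norm (p s - q) \<le> D"
        using diagonal unfolding p_def q_def by (intro norm_diff_le_if_property_C[OF C])
      also have "D = norm (p t - q)" using pq g1[of t] D by (simp add: norm_mult)
      finally show ?thesis .
    qed
    from inner_deriv_eq_0_if_max_norm[OF p this]
    have "(m' t + of_real (D / 2) * g' t) \<bullet> (of_real D * g t) = 0" by (simp add: pq)
    then have "D * (m' t \<bullet> g t + D / 2 * (g' t \<bullet> g t)) = 0"
      by (simp add: inner_complex_def algebra_simps)
    then show "m' t \<bullet> g t = 0" using D gg' by simp
    have "\<gamma>' t \<bullet> (\<i> * g t) = 0"
      by (subst \<gamma>g) (simp add: inner_complex_def)
    moreover have "(\<i> * g' t) \<bullet> (\<i> * g t) = 0"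
      using gg' by (simp add: inner_complex_def algebra_simps)
    moreover have "(of_real a * z) \<bullet> w = a * (z \<bullet> w)" for a and z w :: complex
      by (simp add: inner_complex_def algebra_simps)
    ultimately show "m' t \<bullet> (\<i> * g t) = 0"
      unfolding m'_def inner_add_left by (simp del: of_real_mult of_real_divide)
  qed
  with m have "(m has_vector_derivative 0) (at t within UNIV)" for t by simp
  then obtain c where c: "\<And>t. m t = c"
    using has_vector_derivative_zero_constant[of UNIV m] by auto
  have "\<Gamma> = sphere c (D / 2)"
  proof (rule eq_sphere_if_antipodal)
    show "\<Gamma> \<subseteq> sphere c (D / 2)"
    proof -
      have "norm (\<gamma> t - m t) = D / 2" for t
        using s D g1[of t] unfolding \<gamma>m norm_minus_cancel by (auto simp: norm_mult)
      then have "dist c (\<gamma> t) = D / 2" for t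
        by (simp add: c dist_norm norm_minus_commute)
      then show ?thesis by (auto simp: \<Gamma>)
    qed
    show "connected \<Gamma>" unfolding \<Gamma> by (intro connected_continuous_image \<gamma>c connected_UNIV)
  qed (use antipode c \<Gamma> in auto)
  then show ?thesis ..
qed

section \<open>The circle has both properties\<close>

lemma sphere_eq_range_cis:
  assumes "r > 0"
  shows "sphere c r = range (\<lambda>t. c + of_real r * cis t)"
proof
  show "sphere c r \<subseteq> range (\<lambda>t. c + of_real r * cis t)"
  proof
    fix x assume "x \<in> sphere c r"
    then have "x - c = of_real r * cis (Arg (x - c))"
      using rcis_cmod_Arg[of "x - c"] by (simp add: rcis_def dist_norm norm_minus_commute)
    then have "x = c + of_real r * cis (Arg (x - c))" by (simp add: algebra_simps)
    then show "x \<in> range (\<lambda>t. c + of_real r * cis t)" by blast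
  qed
qed (use assms in \<open>auto simp: dist_norm norm_mult\<close>)

lemma property_C_sphere:
  assumes "D > 0"
  shows "property_C D (sphere (c::complex) (D / 2))"
  unfolding property_C_def
proof
  fix x assume x: "x \<in> sphere c (D / 2)"
  have eq: "z = 2 * c - x" if z: "z \<in> sphere c (D / 2)" and d: "norm (x - z) \<ge> D" for z
  proof -
    \<comment> \<open>The parallelogram law leaves nothing for \<open>x + z - 2 * c\<close> if \<open>x\<close> and \<open>z\<close> are \<open>D\<close> apart.\<close>
    have "norm (x - z) ^ 2 + norm ((x - c) + (z - c)) ^ 2 = 2 * norm (x - c) ^ 2 + 2 * norm (z - c) ^ 2"
      unfolding cmod_power2 by (simp add: power2_eq_square algebra_simps)
    also have "\<dots> = D ^ 2"
    proof -
      have "norm (x - c) = D / 2" "norm (z - c) = D / 2"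
        using x z by (simp_all add: dist_norm norm_minus_commute)
      then show ?thesis by (simp only: power_divide) simp
    qed
    also have "\<dots> \<le> norm (x - z) ^ 2" using d assms by (intro power_mono) auto
    finally have "norm ((x - c) + (z - c)) = 0" by simp
    then show ?thesis by (simp add: algebra_simps)
  qed
  have "norm (x - (2 * c - x)) = norm (2 * (x - c))" by (simp add: algebra_simps)
  also have "\<dots> = D" using x unfolding norm_mult by (simp add: dist_norm norm_minus_commute)
  finally have "norm (x - (2 * c - x)) = D" .
  moreover have "2 * c - x \<in> sphere c (D / 2)"
    using x by (simp add: dist_norm norm_minus_commute)
  moreover have "norm (x - z) < D" if "z \<in> sphere c (D / 2)" "z \<noteq> 2 * c - x" for z
    using eq that not_le by blast
  moreover have "z = 2 * c - x" if "z \<in> sphere c (D / 2)" "norm (x - z) = D" for z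
    using eq[OF that(1)] that(2) by simp
  ultimately show "\<exists>y\<in>sphere c (D / 2). norm (x - y) = D \<and>
      (\<forall>y'\<in>sphere c (D / 2). norm (x - y') = D \<longrightarrow> y' = y) \<and>
      (\<forall>z\<in>sphere c (D / 2). z \<noteq> y \<longrightarrow> norm (x - z) < D)"
    by (intro bexI[of _ "2 * c - x"] conjI ballI impI)
qed

lemma property_C4_sphere:
  assumes D: "D > 0"
  shows "property_Cn 4 (D / sqrt 2) (sphere c (D / 2))"
proof -
  have "2 * (D / 2) * sin (pi / real 4) = D / sqrt 2"
    by (simp add: sin_45 field_simps)
  then show ?thesis
    using property_Cn_epitrochoid[of 4 "D / 2" 0 c] sphere_eq_range_cis[of "D / 2" c] D by simp
qed

theorem mainTheorem1:
  shows "(\<forall>(n::nat) (D::real). n \<ge> 2 \<and> D > 0 \<longrightarrow>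
            (\<exists>\<Gamma>. regular_simple_closed_curve \<infinity> \<Gamma> \<and>
                 \<not> (\<exists>c r. r > 0 \<and> \<Gamma> = sphere c r) \<and> property_Cn n D \<Gamma>)) \<and>
         (\<forall>(D::real) \<Gamma>. D > 0 \<longrightarrow>
            (regular_simple_closed_curve 2 \<Gamma> \<and> property_Cn 4 (D / sqrt 2) \<Gamma> \<and> property_C D \<Gamma>
              \<longleftrightarrow> (\<exists>c. \<Gamma> = sphere c (D / 2))))"
proof (intro conjI allI impI)
  fix n :: nat and D :: real
  assume "n \<ge> 2 \<and> D > 0"
  then show "\<exists>\<Gamma>. regular_simple_closed_curve \<infinity> \<Gamma> \<and>
      \<not> (\<exists>c r. r > 0 \<and> \<Gamma> = sphere c r) \<and> property_Cn n D \<Gamma>"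
    using exists_noncircular_property_Cn by blast
next
  fix D :: real and \<Gamma> :: "complex set"
  assume D: "D > 0"
  have "regular_simple_closed_curve 2 (sphere c (D / 2))" for c
    using regular_simple_closed_epitrochoid[of 3 "D / 2" 0 2 c] sphere_eq_range_cis[of "D / 2" c] D
    by simp
  then show "regular_simple_closed_curve 2 \<Gamma> \<and> property_Cn 4 (D / sqrt 2) \<Gamma> \<and> property_C D \<Gamma>
      \<longleftrightarrow> (\<exists>c. \<Gamma> = sphere c (D / 2))"
    using sphere_if_property_C4_and_C[OF D] property_C4_sphere[OF D] property_C_sphere[OF D] by blast
qed

end
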